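(* Let $\mathcal{K}$ be a finite simplicial complex in $\mathbb{R}^d$ with vertex set $V\subset\mathbb{R}^d$, let $k$ be a homology degree with $0\le k\le d$, and let $R\in SO(d)$ be a rotation. Let $R\mathcal{K}$ be the simplicial complex with vertex set $RV=\{Rx:x\in V\}$ whose simplices are the images under $R$ of the simplices of $\mathcal{K}$. Then $$\mathrm{PET}^{(k)}_{R\mathcal{K}}(v)=\mathrm{PET}^{(k)}_{\mathcal{K}}(R^{\top}v)\qquad\text{for all } v\in S^{d-1}.$$
   Context: A simplicial complex $\mathcal{K}$ in $\mathbb{R}^d$ with finite vertex set $V\subset\mathbb{R}^d$ is a finite collection of simplices (convex hulls of affinely independent subsets of $V$) closed under taking faces and such that any two simplices intersect in a common face or not at all. For $v\in S^{d-1}$ (the unit sphere in $\mathbb{R}^d$), the directional height function is $f_v:V\to\mathbb{R}$, $f_v(x)=\langle x,v\rangle$. Its lower-star filtration assigns to each simplex the maximum of $f_v$ over its vertices; the sublevel complex at $t$ is $\{\sigma\in\mathcal{K}:\max_{x\in\sigma}f_v(x)\le t\}$. $D_k(f_v)$ is the $k$-dimensional persistence diagram (persistent homology with coefficients in a fixed field) of this filtration, a finite multiset of pairs $(b_i,d_i)$, $i\in I$, with $b_i\le d_i$ finite; classes that never die are assigned death time $\max_{x\in V} f_v(x)$. Persistent entropy of a finite diagram $D=\{(b_i,d_i)\}_{i\in I}$: with $\ell_i=d_i-b_i$, $L=\sum_{i\in I}\ell_i$ and $p_i=\ell_i/L$, one sets $\mathrm{PE}(D)=-\sum_{i\in I}p_i\log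 p_i$, where $\log$ is the natural logarithm and $0\log 0=0$; if $D$ is empty or $L=0$, then $\mathrm{PE}(D)=0$. The persistent entropy transform of $\mathcal{K}$ in homology degree $k$ is the function $\mathrm{PET}^{(k)}_{\mathcal{K}}:S^{d-1}\to\mathbb{R}$, $v\mapsto \mathrm{PE}(D_k(f_v))$. *)

theory Defs
  imports "HOL-Analysis.Analysis" "HOL-Combinatorics.Permutations"
    "HOL-Library.Function_Algebras" "HOL-Library.Multiset"
begin

section \<open>Geometric simplicial complexes\<close>

text \<open>
  The library predicate \<^const>\<open>simplicial_complex\<close> counts the empty set as a face of every
  simplex. Here, as usual for unreduced homology, simplices are non-empty.
\<close>

definition geometric_complex :: "'a::euclidean_space set \<Rightarrow> 'a set set \<Rightarrow> bool" where
  "geometric_complex V K \<longleftrightarrow>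
     finite V \<and> {} \<notin> K \<and> simplicial_complex (insert {} K) \<and>
     (\<forall>\<sigma>\<in>K. \<exists>C\<subseteq>V. \<not> affine_dependent C \<and> \<sigma> = convex hull C)"

definition vertices :: "'a::real_vector set \<Rightarrow> 'a set" where
  "vertices \<sigma> = {x. x extreme_point_of \<sigma>}"

lemma vertices_convex_hull:
  fixes C :: "'a::euclidean_space set"
  assumes "\<not> affine_dependent C"
  shows "vertices (convex hull C) = C"
  using assms by (simp add: vertices_def extreme_point_of_convex_hull_affine_independent)

definition sublevel_complex :: "('a::real_vector \<Rightarrow> real) \<Rightarrow> 'a set set \<Rightarrow> real \<Rightarrow> 'a set set" where
  "sublevel_complex f K t = {\<sigma> \<in> K. Max (f ` vertices \<sigma>) \<le> t}"

section \<open>Simplicial homology with field coefficients\<close>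

text \<open>
  A \<open>k\<close>-chain is an alternating function on the oriented \<open>k\<close>-simplices. An oriented simplex is
  represented by the lists of its vertices, up to even permutations; the value of \<open>c\<close> at \<open>xs\<close> is
  the coefficient of \<open>[xs]\<close>. No order on the vertices needs to be chosen.
\<close>

definition chains :: "'a::real_vector set set \<Rightarrow> nat \<Rightarrow> ('a list \<Rightarrow> 'f::field) set" where
  "chains K k = {c.
     (\<forall>xs. c xs \<noteq> 0 \<longrightarrow> length xs = Suc k \<and> distinct xs \<and> (\<exists>\<sigma>\<in>K. set xs = vertices \<sigma>)) \<and>
     (\<forall>xs p. p permutes {..<length xs} \<longrightarrow> c (permute_list p xs) = of_int (sign p) * c xs)}"

text \<open>
  The boundary of \<open>[x\<^sub>0, \<dots>, x\<^sub>k]\<close> is the alternating sum of its faces. Since \<open>xs\<close> is the face of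
  \<open>x # xs\<close> opposite to its first vertex, with sign \<open>+1\<close>, and every coface of \<open>xs\<close> has
  an orientation of the form \<open>x # xs\<close>, the coefficient of the boundary of \<open>c\<close> at \<open>xs\<close> is the sum
  of the coefficients \<open>c (x # xs)\<close>. The empty list is excluded: the boundary of a 0-chain is 0.
  For chains of a finite complex, the sum has finitely many terms.
\<close>

definition boundary :: "('a list \<Rightarrow> 'f::field) \<Rightarrow> 'a list \<Rightarrow> 'f" where
  "boundary c xs = (if xs = [] then 0 else \<Sum>x | c (x # xs) \<noteq> 0. c (x # xs))"

definition cycles :: "'a::real_vector set set \<Rightarrow> nat \<Rightarrow> ('a list \<Rightarrow> 'f::field) set" where
  "cycles K k = {c \<in> chains K k. boundary c = 0}"

definition boundaries :: "'a::real_vector set set \<Rightarrow> nat \<Rightarrow> ('a list \<Rightarrow> 'f::field) set" where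
  "boundaries K k = boundary ` chains K (Suc k)"

definition scale_chain :: "'f::field \<Rightarrow> ('a list \<Rightarrow> 'f) \<Rightarrow> 'a list \<Rightarrow> 'f" where
  "scale_chain a c = (\<lambda>xs. a * c xs)"

interpretation chain: vector_space scale_chain
  by unfold_locales (auto simp: scale_chain_def fun_eq_iff algebra_simps)

text \<open>
  For \<open>K \<subseteq> L\<close>, the rank of the map from the \<open>k\<close>-th homology of \<open>K\<close> to that of \<open>L\<close> induced by the
  inclusion. Its image is the quotient of the cycles of \<open>K\<close> by those cycles of \<open>K\<close> that are boundaries
  in \<open>L\<close>, and the dimension of a quotient of finite-dimensional spaces is the difference of the
  dimensions (cf. the lemma \<open>card_quotient_basis\<close> below).
  The first argument only fixes the field of coefficients.
\<close>

definition persistent_betti ::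
  "'f::field itself \<Rightarrow> nat \<Rightarrow> 'a::real_vector set set \<Rightarrow> 'a set set \<Rightarrow> nat" where
  "persistent_betti F k K L =
     chain.dim (cycles K k :: ('a list \<Rightarrow> 'f) set) -
     chain.dim (cycles K k \<inter> boundaries L k :: ('a list \<Rightarrow> 'f) set)"

text \<open>\<open>S\<close> represents a basis of \<open>U\<close> modulo \<open>W\<close>.\<close>

lemma (in vector_space) card_quotient_basis:
  assumes U: "subspace U" and W: "subspace W" and "finite T" "U \<subseteq> span T"
    and S: "S \<subseteq> U"
    and indep: "\<And>s. s \<in> S \<Longrightarrow> s \<notin> span ((S - {s}) \<union> W)"
    and span: "U \<subseteq> span (S \<union> W)"
  shows "card S = dim U - dim (U \<inter> W)"
proof -
  have UW: "subspace (U \<inter> W)" using U W by (rule subspace_inter)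
  obtain B where B: "B \<subseteq> U \<inter> W" "independent B" "U \<inter> W \<subseteq> span B" "card B = dim (U \<inter> W)"
    using basis_exists by blast
  have step: "independent (A \<union> B)" if "finite A" "A \<subseteq> S" for A
    using that
  proof induction
    case empty
    then show ?case using B by simp
  next
    case (insert s A)
    have "A \<union> B \<subseteq> (S - {s}) \<union> W" using insert B by auto
    then have "s \<notin> span (A \<union> B)" using indep[of s] insert.prems span_mono by blast
    then show ?case using insert by (simp add: independent_insertI)
  qed
  have "independent S"
    unfolding dependent_def using indep span_mono[of "S - {_}" "(S - {_}) \<union> W"] by blast
  then have fin: "finite S" using independent_span_bound[OF \<open>finite T\<close>] S \<open>U \<subseteq> span T\<close> by blast
  have finB: "finite B" using independent_span_bound[OF \<open>finite T\<close> \<open>independent B\<close>] B \<open>U \<subseteq> span T\<close>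
    by blast
  have disj: "S \<inter> B = {}"
  proof -
    have "s \<notin> B" if "s \<in> S" for s
    proof
      assume "s \<in> B"
      then have "s \<in> (S - {s}) \<union> W" using B by blast
      then show False using indep[OF that] span_base by blast
    qed
    then show ?thesis by blast
  qed
  have "U \<subseteq> span (S \<union> B)"
  proof
    fix u assume u: "u \<in> U"
    then obtain a w where aw: "u = a + w" "a \<in> span S" "w \<in> span W"
      using span unfolding span_Un by blast
    have "a \<in> U" using aw(2) span_minimal[OF S U] by blast
    moreover have "w \<in> W" using aw(3) span_eq_iff W by blast
    moreover have "w = u - a" using aw by simp
    ultimately have "w \<in> U \<inter> W" using u subspace_diff[OF U] by blast
    then have "w \<in> span B" using B by blast
    then show "u \<in> span (S \<union> B)" using aw unfolding span_Un by blast
  qed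
  moreover have "S \<union> B \<subseteq> U" using S B by blast
  ultimately have "dim U = card (S \<union> B)"
    using basis_card_eq_dim[of "S \<union> B" U] step[OF fin] by simp
  also have "\<dots> = card S + card B" using fin finB disj by (simp add: card_Un_disjoint)
  finally show ?thesis using B by simp
qed

section \<open>Persistence diagrams of lower-star filtrations\<close>

text \<open>
  With \<open>a\<^sub>1 < \<dots> < a\<^sub>n\<close> the values of \<open>f\<close> on \<open>V\<close>, the filtration is
  \<open>{} = K\<^sub>0 \<subseteq> K\<^sub>1 \<subseteq> \<dots> \<subseteq> K\<^sub>n\<close>, where \<open>K\<^sub>i\<close> is the sublevel complex at \<open>a\<^sub>i\<close>.
\<close>

definition filtration_value :: "'a set \<Rightarrow> ('a \<Rightarrow> real) \<Rightarrow> nat \<Rightarrow> real" where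
  "filtration_value V f i = sorted_list_of_set (f ` V) ! (i - 1)"

definition filtration_stage ::
  "'a::real_vector set \<Rightarrow> 'a set set \<Rightarrow> ('a \<Rightarrow> real) \<Rightarrow> nat \<Rightarrow> 'a set set" where
  "filtration_stage V K f i =
     (if i = 0 then {} else sublevel_complex f K (filtration_value V f i))"

text \<open>
  The multiplicity of a pair \<open>(a\<^sub>i, a\<^sub>j)\<close> is the number of independent classes born at stage \<open>i\<close> that die
  entering stage \<open>j\<close>, by the usual inclusion-exclusion for persistent Betti numbers. The
  second sum is over the classes that never die, whose death time is the maximum of \<open>f\<close>.
\<close>

definition persistence_diagram ::
  "'f::field itself \<Rightarrow> nat \<Rightarrow> 'a::real_vector set \<Rightarrow> 'a set set \<Rightarrow> ('a \<Rightarrow> real) \<Rightarrow> (real \<times> real) multiset"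
  where
  "persistence_diagram F k V K f =
     (let n = card (f ` V);
          a = filtration_value V f;
          \<beta> = (\<lambda>i j. int (persistent_betti F k (filtration_stage V K f i) (filtration_stage V K f j)))
      in (\<Sum>i\<in>{1..n}. \<Sum>j\<in>{i<..n}.
            replicate_mset (nat ((\<beta> i (j - 1) - \<beta> i j) - (\<beta> (i - 1) (j - 1) - \<beta> (i - 1) j))) (a i, a j))
         + (\<Sum>i\<in>{1..n}. replicate_mset (nat (\<beta> i n - \<beta> (i - 1) n)) (a i, Max (f ` V))))"

section \<open>Persistent entropy\<close>

definition persistent_entropy :: "(real \<times> real) multiset \<Rightarrow> real" where
  "persistent_entropy D =
     (let L = (\<Sum>(b, d)\<in>#D. d - b)
      in if L = 0 then 0 else - (\<Sum>(b, d)\<in>#D. (d - b) / L * ln ((d - b) / L)))"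

definition height :: "'a::real_inner \<Rightarrow> 'a \<Rightarrow> real" where
  "height v x = x \<bullet> v"

definition PET ::
  "'f::field itself \<Rightarrow> nat \<Rightarrow> 'a::real_inner set \<Rightarrow> 'a set set \<Rightarrow> 'a \<Rightarrow> real" where
  "PET F k V K v = persistent_entropy (persistence_diagram F k V K (height v))"

end

theory Submission
  imports Defs
begin

text \<open>
  Persistent entropy depends on a complex and a function on its vertices only up to isomorphism,
  and a rotation is an isomorphism. An invertible linear map \<open>T\<close> carries the vertices of each
  simplex to the vertices of its image. Since an oriented simplex is a list of vertices,
  relabelling \<open>c \<mapsto> c \<circ> map T\<close> is a linear bijection from the functions on lists in the target space to
  those in the source space, and it identifies the chains of \<open>T K\<close> with those of \<open>K\<close>. It commutes
  with the boundary operator, so it also identifies cycles, boundaries and their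
  intersections, and persistent Betti numbers agree (\<open>persistent_betti_image\<close>). The lower-star
  filtration of \<open>T K\<close> by \<open>f\<close> is the image of that of \<open>K\<close> by \<open>f \<circ> T\<close>, with the same filtration
  values, whence the two persistence diagrams are equal as multisets
  (\<open>persistence_diagram_image\<close>).

  For a matrix \<open>R\<close> the pullback of the height function in direction \<open>v\<close> is the height function
  in direction \<open>R\<^sup>T v\<close>, because \<open>R x \<bullet> v = x \<bullet> R\<^sup>T v\<close>.
\<close>

lemma extreme_point_of_linear_image:
  assumes "linear T" "inj T"
  shows "T x extreme_point_of T ` S \<longleftrightarrow> x extreme_point_of S"
  using face_of_linear_image[OF assms, of "{x}" S] by (simp add: face_of_singleton)

lemma vertices_linear_image:
  assumes "linear T" "inj T"
  shows "vertices (T ` \<sigma>) = T ` vertices \<sigma>"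
proof -
  have "y \<in> T ` \<sigma>" if "y extreme_point_of T ` \<sigma>" for y
    using that by (simp add: extreme_point_of_def)
  then show ?thesis
    using extreme_point_of_linear_image[OF assms] unfolding vertices_def by blast
qed

definition relabel :: "('a \<Rightarrow> 'b) \<Rightarrow> ('b list \<Rightarrow> 'f) \<Rightarrow> 'a list \<Rightarrow> 'f" where
  "relabel T c = c \<circ> map T"

lemma relabel_apply [simp]: "relabel T c xs = c (map T xs)"
  by (simp add: relabel_def)

lemma bij_relabel:
  assumes "bij T"
  shows "bij (relabel T :: ('b list \<Rightarrow> 'f) \<Rightarrow> _)"
proof (rule bij_betw_byWitness[where f' = "relabel (inv T)"])
  have "map T \<circ> map (inv T) = id" "map (inv T) \<circ> map T = id"
    using assms by (auto simp: fun_eq_iff bij_is_inj surj_f_inv_f[OF bij_is_surj] intro: map_idI)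
  then show "\<forall>c\<in>UNIV. relabel (inv T) (relabel T c) = (c :: 'b list \<Rightarrow> 'f)"
    and "\<forall>c\<in>UNIV. relabel T (relabel (inv T) c) = c"
    by (simp_all add: relabel_def comp_assoc)
qed auto

lemma linear_relabel: "Vector_Spaces.linear scale_chain scale_chain (relabel T)"
  by unfold_locales (auto simp: scale_chain_def fun_eq_iff)

text \<open>
  The space of all functions on lists, in which chains live, is in general infinite-dimensional.
  An arbitrary basis of \<open>S\<close> is transported; its image has the same
  cardinality, also in the degenerate case of an infinite basis, where \<open>card\<close> is 0.
\<close>

lemma (in vector_space_pair) dim_linear_inj_image:
  assumes "Vector_Spaces.linear s1 s2 f" "inj f"
  shows "vs2.dim (f ` S) = vs1.dim S"
proof -
  obtain B where B: "B \<subseteq> S" "vs1.independent B" "S \<subseteq> vs1.span B" "card B = vs1.dim S"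
    using vs1.basis_exists by blast
  have "vs2.independent (f ` B)"
    using inj_on_subset[OF assms(2) subset_UNIV]
    by (rule linear_independent_injective_image[OF assms(1) B(2)])
  moreover have "f ` S \<subseteq> vs2.span (f ` B)"
    using B by (auto simp: linear_span_image[OF assms(1)])
  ultimately have "card (f ` B) = vs2.dim (f ` S)"
    using B by (intro vs2.basis_card_eq_dim) auto
  then show ?thesis
    using B assms(2) by (simp add: card_image inj_on_subset)
qed

lemma dim_relabel_vimage:
  assumes "bij T"
  shows "chain.dim (relabel T -` S) = chain.dim S"
proof -
  interpret vector_space_pair scale_chain scale_chain by unfold_locales
  have "chain.dim (relabel T ` (relabel T -` S)) = chain.dim (relabel T -` S)"
    using bij_relabel[OF assms] by (intro dim_linear_inj_image linear_relabel) (rule bij_is_inj)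
  then show ?thesis
    using bij_relabel[OF assms] by (metis surj_image_vimage_eq bij_is_surj)
qed

text \<open>
  Stated with preimages under \<open>relabel T\<close>, this and its analogues for cycles and boundaries
  combine under intersection without further work. The support condition transfers because
  \<open>T\<close> preserves vertex sets, and the sign condition because permuting the entries of a
  list commutes with \<open>map T\<close>.
\<close>

lemma chains_image:
  assumes "linear T" "bij T"
  shows "chains ((`) T ` K) k = relabel T -` chains K k"
proof -
  have inj: "inj T"
    using assms(2) by (rule bij_is_inj)
  have surj: "surj (map T)"
    using bij_lists[OF assms(2)] by (simp add: bij_is_surj)
  have supp: "(length (map T xs) = Suc k \<and> distinct (map T xs) \<and>
      (\<exists>\<tau>\<in>(`) T ` K. set (map T xs) = vertices \<tau>)) \<longleftrightarrow>
      (length xs = Suc k \<and> distinct xs \<and> (\<exists>\<sigma>\<in>K. set xs = vertices \<sigma>))" for xs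
    using inj by (auto simp: vertices_linear_image[OF assms(1) inj] distinct_map
        inj_image_eq_iff intro: inj_on_subset)
  have all: "(\<forall>ys. P ys) \<longleftrightarrow> (\<forall>xs. P (map T xs))" for P
    using surj by (metis surj_def)
  show ?thesis
    unfolding chains_def
    by (rule set_eqI, simp only: vimage_eq mem_Collect_eq all supp relabel_apply)
      (simp add: permute_list_map)
qed

text \<open>
  The boundary sums over all points that extend a list to a coface, and \<open>T\<close> reindexes this sum.
\<close>

lemma boundary_relabel:
  assumes "bij T"
  shows "boundary (relabel T c) = relabel T (boundary c)"
proof
  fix xs
  have "bij_betw T {x. c (T x # map T xs) \<noteq> 0} {y. c (y # map T xs) \<noteq> 0}"
    using assms by (auto simp: bij_betw_def inj_on_def surj_def)
  then have "(\<Sum>x | c (T x # map T xs) \<noteq> 0. c (T x # map T xs)) =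
      (\<Sum>y | c (y # map T xs) \<noteq> 0. c (y # map T xs))"
    by (rule sum.reindex_bij_betw)
  then show "boundary (relabel T c) xs = relabel T (boundary c) xs"
    by (simp add: boundary_def)
qed

lemma cycles_image:
  assumes "linear T" "bij T"
  shows "cycles ((`) T ` K) k = (relabel T -` cycles K k :: ('b::real_vector list \<Rightarrow> 'f::field) set)"
proof -
  have "relabel T c = 0 \<longleftrightarrow> c = 0" for c :: "'b list \<Rightarrow> 'f"
    using inj_eq[OF bij_is_inj[OF bij_relabel[OF assms(2)]], of c 0]
    by (simp add: relabel_def fun_eq_iff)
  then show ?thesis
    by (auto simp: cycles_def chains_image[OF assms] boundary_relabel[OF assms(2)])
qed

lemma boundaries_image:
  assumes "linear T" "bij T"
  shows "boundaries ((`) T ` K) k = relabel T -` boundaries K k"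
proof -
  note bij = bij_relabel[OF assms(2)]
  have "relabel T c \<in> boundary ` chains K (Suc k) \<longleftrightarrow>
      c \<in> boundary ` relabel T -` chains K (Suc k)" for c
  proof
    assume "relabel T c \<in> boundary ` chains K (Suc k)"
    then obtain e where "e \<in> chains K (Suc k)" "relabel T c = boundary e"
      by blast
    \<comment> \<open>Every bounding chain in the source is itself relabelled from the target.\<close>
    moreover obtain e' where "e = relabel T e'"
      using bij_is_surj[OF bij] by blast
    ultimately show "c \<in> boundary ` relabel T -` chains K (Suc k)"
      using bij_is_inj[OF bij] by (auto simp: boundary_relabel[OF assms(2)] dest: injD)
  next
    assume "c \<in> boundary ` relabel T -` chains K (Suc k)"
    then show "relabel T c \<in> boundary ` chains K (Suc k)"
      by (auto simp flip: boundary_relabel[OF assms(2)])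
  qed
  then show ?thesis
    by (auto simp: boundaries_def chains_image[OF assms])
qed

lemma persistent_betti_image:
  assumes "linear T" "bij T"
  shows "persistent_betti F k ((`) T ` K) ((`) T ` L) = persistent_betti F k K L"
  unfolding persistent_betti_def
  by (simp add: cycles_image[OF assms] boundaries_image[OF assms]
      dim_relabel_vimage[OF assms(2)] flip: vimage_Int)

lemma sublevel_complex_image:
  assumes "linear T" "inj T"
  shows "sublevel_complex f ((`) T ` K) t = (`) T ` sublevel_complex (f \<circ> T) K t"
  by (auto simp: sublevel_complex_def vertices_linear_image[OF assms] image_comp)

lemma filtration_value_image: "filtration_value (T ` V) f = filtration_value V (f \<circ> T)"
  by (simp add: filtration_value_def image_comp fun_eq_iff)

lemma filtration_stage_image:
  assumes "linear T" "inj T"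
  shows "filtration_stage (T ` V) ((`) T ` K) f i = (`) T ` filtration_stage V K (f \<circ> T) i"
  by (simp add: filtration_stage_def sublevel_complex_image[OF assms] filtration_value_image)

lemma persistence_diagram_image:
  assumes "linear T" "bij T"
  shows "persistence_diagram F k (T ` V) ((`) T ` K) f = persistence_diagram F k V K (f \<circ> T)"
  unfolding persistence_diagram_def filtration_stage_image[OF assms(1) bij_is_inj[OF assms(2)]]
    persistent_betti_image[OF assms] filtration_value_image image_comp ..

lemma PET_image:
  assumes "linear T" "bij T"
  shows "PET F k (T ` V) ((`) T ` K) v =
    persistent_entropy (persistence_diagram F k V K (height v \<circ> T))"
  by (simp add: PET_def persistence_diagram_image[OF assms])

lemma height_matrix_vector_mult: "height v \<circ> (*v) R = height (transpose R *v v)"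
  for R :: "real ^ 'n ^ 'm"
  by (simp add: height_def fun_eq_iff inner_commute[of _ v] inner_commute[of _ "v v* R"] dot_lmul_matrix)

theorem proposition3:
  fixes V :: "(real ^ 'n) set" and K :: "(real ^ 'n) set set"
    and R :: "real ^ 'n ^ 'n" and k :: nat
  assumes "geometric_complex V K"
    and "k \<le> CARD('n)"
    and "orthogonal_matrix R" and "det R = 1"
  shows "\<forall>v \<in> sphere 0 1.
    PET TYPE('f::field) k ((*v) R ` V) ((\<lambda>\<sigma>. (*v) R ` \<sigma>) ` K) v
      = PET TYPE('f) k V K (transpose R *v v)"
proof
  fix v :: "real ^ 'n"
  have "orthogonal_transformation ((*v) R)"
    using assms(3) by (simp add: orthogonal_transformation_matrix)
  then have "linear ((*v) R)" "bij ((*v) R)"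
    by (rule orthogonal_transformation_linear, rule orthogonal_transformation_bij)
  then show "PET TYPE('f) k ((*v) R ` V) ((\<lambda>\<sigma>. (*v) R ` \<sigma>) ` K) v
      = PET TYPE('f) k V K (transpose R *v v)"
    by (simp only: PET_image height_matrix_vector_mult PET_def[of _ _ V])
qed

end
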